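(* Let $T$ be a finite tree, let $r$ be any vertex of $T$, and let $\mathcal{P}$ be the partition produced by outward-contraction with root $r$. Let $\overline{T}=T(\mathcal{P})$ be the resulting partition-tree and $\varphi:V(T)\to V(\overline{T})$ the natural mapping. Then the center-shift of $\varphi$ is zero, i.e. $\varphi^{-1}(C_{\overline{T}})\cap C_T\neq\emptyset$, where $C_T$ and $C_{\overline{T}}$ are the centers of $T$ and $\overline{T}$.
   Context: Distances are shortest-path distances; the eccentricity of $v$ is $\max_x d(v,x)$ and the center is the set of vertices of minimum eccentricity. Outward-contraction: with root $r$, let $\mathrm{lev}(v)=d(v,r)$; for every vertex $v$ with $\mathrm{lev}(v)$ even, let $N_\downarrow(v)$ be the set of neighbours $u$ of $v$ with $\mathrm{lev}(u)>\mathrm{lev}(v)$, and form the super-vertex $\{v\}\cup N_\downarrow(v)$; these super-vertices form a partition $\mathcal{P}$ of $V(T)$. The partition-graph $T(\mathcal{P})$ has the super-vertices as vertices, two distinct super-vertices being adjacent iff some vertex of one is adjacent in $T$ to some vertex of the other; the natural mapping sends each vertex to the super-vertex containing it. The center-shift of a surjective map $\varphi:G\to H$ is $d_G(C_G,\varphi^{-1}(C_H))$, where $d_G(S_1,S_2)=\min\{d_G(a,b):a\in S_1,b\in S_2\}$. *)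

theory Defs
  imports "Graph_Theory.Graph_Theory"
begin

text \<open>
  A finite simple graph is a \<open>pair_graph\<close>: a finite, symmetric, loop-free set of arcs. The notion
  \<open>tree\<close> of Graph_Theory cannot be used for such graphs: there every edge, read as a pair of
  opposite arcs, is a \<open>cycle\<close> of length 2, so only the one-vertex graph would be a tree. Cycles of
  the undirected graph are the ones of length at least 3.
\<close>

definition undirected_tree :: "'a pair_pre_digraph \<Rightarrow> bool" where
  "undirected_tree T \<longleftrightarrow> pair_graph T \<and> Digraph_Component.connected (with_proj T)
     \<and> \<not> (\<exists>p. pre_digraph.cycle (with_proj T) p \<and> 3 \<le> length p)"

text \<open>
  The distance is meaningful only between vertices joined by a walk. It is the
  shortest-path distance \<open>\<mu>\<close> of Graph_Theory for unit weights, but with values in \<open>nat\<close>, since the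
  parity of distances is needed.
\<close>

definition gdist :: "('a, 'b) pre_digraph \<Rightarrow> 'a \<Rightarrow> 'a \<Rightarrow> nat" where
  "gdist G u v = (LEAST n. \<exists>p. pre_digraph.awalk G u p v \<and> length p = n)"

lemma (in wf_digraph) gdist_eq_mu:
  assumes "u \<rightarrow>\<^sup>* v"
  shows "\<mu> (\<lambda>_. 1) u v = ereal (real (gdist G u v))"
proof -
  have cost: "awalk_cost (\<lambda>_. 1) p = real (length p)" for p :: "'b awalk"
    by (induction p) auto
  have ex: "\<exists>n. \<exists>p. awalk u p v \<and> length p = n"
    using assms by (auto simp: reachable_awalk)
  obtain p where p: "awalk u p v" "length p = gdist G u v"
    using LeastI_ex[OF ex] unfolding gdist_def by blast
  have le: "gdist G u v \<le> length q" if "awalk u q v" for q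
    unfolding gdist_def using that by (intro Least_le) blast
  show ?thesis
    unfolding \<mu>_def cost
  proof (rule antisym)
    show "(INF p\<in>{p. awalk u p v}. ereal (real (length p))) \<le> ereal (real (gdist G u v))"
      using p by (intro INF_lower2[of p]) auto
    show "ereal (real (gdist G u v)) \<le> (INF p\<in>{p. awalk u p v}. ereal (real (length p)))"
      using le by (intro INF_greatest) auto
  qed
qed

definition eccentricity :: "('a, 'b) pre_digraph \<Rightarrow> 'a \<Rightarrow> nat" where
  "eccentricity G v = Max (gdist G v ` verts G)"

definition graph_center :: "('a, 'b) pre_digraph \<Rightarrow> 'a set" where
  "graph_center G = {v \<in> verts G. \<forall>u \<in> verts G. eccentricity G v \<le> eccentricity G u}"

definition set_dist :: "('a, 'b) pre_digraph \<Rightarrow> 'a set \<Rightarrow> 'a set \<Rightarrow> nat" where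
  "set_dist G S1 S2 = Min {gdist G a b | a b. a \<in> S1 \<and> b \<in> S2}"

text \<open>
  In \<open>center_preimage\<close> and \<open>center_shift\<close>, the map \<open>\<phi>\<close> goes from the vertices of \<open>G\<close> to those
  of \<open>H\<close>; its values outside \<open>verts G\<close> are irrelevant.
\<close>

definition center_preimage ::
  "('a, 'b) pre_digraph \<Rightarrow> ('c, 'd) pre_digraph \<Rightarrow> ('a \<Rightarrow> 'c) \<Rightarrow> 'a set" where
  "center_preimage G H \<phi> = {v \<in> verts G. \<phi> v \<in> graph_center H}"

definition center_shift ::
  "('a, 'b) pre_digraph \<Rightarrow> ('c, 'd) pre_digraph \<Rightarrow> ('a \<Rightarrow> 'c) \<Rightarrow> nat" where
  "center_shift G H \<phi> = set_dist G (graph_center G) (center_preimage G H \<phi>)"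

definition partition_graph :: "'a pair_pre_digraph \<Rightarrow> 'a set set \<Rightarrow> 'a set pair_pre_digraph" where
  "partition_graph T P = \<lparr> pverts = P,
     parcs = {(A, B). A \<in> P \<and> B \<in> P \<and> A \<noteq> B \<and> (\<exists>a \<in> A. \<exists>b \<in> B. (a, b) \<in> parcs T)} \<rparr>"

definition natural_map :: "'a set set \<Rightarrow> 'a \<Rightarrow> 'a set" where
  "natural_map P v = (THE A. A \<in> P \<and> v \<in> A)"

definition level :: "'a pair_pre_digraph \<Rightarrow> 'a \<Rightarrow> 'a \<Rightarrow> nat" where
  "level T r v = gdist (with_proj T) v r"

definition down_neighbours :: "'a pair_pre_digraph \<Rightarrow> 'a \<Rightarrow> 'a \<Rightarrow> 'a set" where
  "down_neighbours T r v = {u. (v, u) \<in> parcs T \<and> level T r v < level T r u}"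

definition outward_contraction :: "'a pair_pre_digraph \<Rightarrow> 'a \<Rightarrow> 'a set set" where
  "outward_contraction T r =
     {{v} \<union> down_neighbours T r v | v. v \<in> pverts T \<and> even (level T r v)}"

end

theory Submission
  imports Defs
begin

text \<open>
  Root the tree at \<open>r\<close> and let \<open>m\<close> be the level of the last common ancestor of \<open>u\<close> and \<open>v\<close>. Then
  \<open>d(u, v) = lev u + lev v - 2 m\<close>. A super-vertex is represented by its vertex of even level, so that
  the contracted graph is again a rooted tree in which all levels are halved (rounding down), and
  \<open>d(\<phi> u, \<phi> v) = \<lfloor>lev u / 2\<rfloor> + \<lfloor>lev v / 2\<rfloor> - 2 \<lfloor>m / 2\<rfloor>\<close>. In any graph, a vertex \<open>c\<close> is central as soon as
  \<open>2 ecc(c) \<le> d(x, y) + 1\<close> for some pair \<open>x\<close>, \<open>y\<close>. Let \<open>x\<close>, \<open>y\<close> be a diametral pair of \<open>T\<close> with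
  \<open>lev y \<le> lev x\<close>. A middle vertex \<open>c\<close> of the path between them is an ancestor of \<open>x\<close> and satisfies
  this criterion in \<open>T\<close>. Every vertex not below \<open>c\<close> branches off above \<open>c\<close>, so the path from it to \<open>x\<close>
  passes through \<open>c\<close>; counting parities shows that \<open>\<phi> c\<close> satisfies the criterion in the contracted
  tree, with the pair \<open>\<phi> x\<close>, \<open>\<phi> y\<close> or a pair \<open>\<phi> x\<close>, \<open>\<phi> z\<close>. When the diameter is odd there are two
  middle vertices, and the right one has to be chosen.
\<close>

section \<open>Distances in rooted trees\<close>

text \<open>The tree is encoded by levels and a parent map, so that both distances become arithmetic
  in levels and meets; walks enter only later.\<close>

locale rooted_tree =
  fixes V :: "'a set" and l :: "'a \<Rightarrow> nat" and p :: "'a \<Rightarrow> 'a" and r :: 'a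
  assumes finite_V: "finite V"
    and root_in: "r \<in> V"
    and lev_root: "l r = 0"
    and lev_0D: "\<lbrakk>v \<in> V; l v = 0\<rbrakk> \<Longrightarrow> v = r"
    and parent_in: "\<lbrakk>v \<in> V; v \<noteq> r\<rbrakk> \<Longrightarrow> p v \<in> V"
    and lev_parent: "\<lbrakk>v \<in> V; v \<noteq> r\<rbrakk> \<Longrightarrow> l v = Suc (l (p v))"
begin

text \<open>The ancestor of \<open>v\<close> on level \<open>k\<close>. For \<open>k\<close> above
  \<open>l v\<close>, truncated subtraction makes it \<open>v\<close> itself.\<close>

definition anc :: "nat \<Rightarrow> 'a \<Rightarrow> 'a" where
  "anc k v = (p ^^ (l v - k)) v"

text \<open>The level of the last common ancestor.\<close>

definition meet :: "'a \<Rightarrow> 'a \<Rightarrow> nat" where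
  "meet u v = Max {k. k \<le> l u \<and> k \<le> l v \<and> anc k u = anc k v}"

lemma anc_self [simp]: "anc (l v) v = v"
  by (simp add: anc_def)

lemma anc_parent:
  assumes "v \<in> V" "v \<noteq> r" "k \<le> l (p v)"
  shows "anc k (p v) = anc k v"
proof -
  have "l v - k = Suc (l (p v) - k)"
    using lev_parent[OF assms(1,2)] assms(3) by simp
  then show ?thesis
    by (simp only: anc_def funpow_Suc_right o_apply)
qed

lemma anc_props:
  assumes "v \<in> V" "k \<le> l v"
  shows "anc k v \<in> V \<and> l (anc k v) = k \<and> (\<forall>j\<le>k. anc j (anc k v) = anc j v)"
  using assms
proof (induction "l v - k" arbitrary: v)
  case 0
  then have "k = l v" by simp
  with 0 show ?case by simp
next
  case (Suc n)
  then have "v \<noteq> r" using lev_root by force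
  then have "l v = Suc (l (p v))" "p v \<in> V"
    using Suc.prems lev_parent parent_in by blast+
  moreover from this Suc.hyps(2) have "k \<le> l (p v)" by simp
  ultimately show ?case
    using Suc.hyps(1)[of "p v"] Suc.hyps(2) anc_parent[OF Suc.prems(1) \<open>v \<noteq> r\<close>] by simp
qed

lemma anc_in: "\<lbrakk>v \<in> V; k \<le> l v\<rbrakk> \<Longrightarrow> anc k v \<in> V"
  and lev_anc: "\<lbrakk>v \<in> V; k \<le> l v\<rbrakk> \<Longrightarrow> l (anc k v) = k"
  and anc_anc: "\<lbrakk>v \<in> V; k \<le> l v; j \<le> k\<rbrakk> \<Longrightarrow> anc j (anc k v) = anc j v"
  using anc_props by blast+

lemma anc_eq_mono:
  assumes "u \<in> V" "v \<in> V" "k \<le> l u" "k \<le> l v" "anc k u = anc k v" "j \<le> k"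
  shows "anc j u = anc j v"
  using anc_anc[OF assms(1,3,6)] anc_anc[OF assms(2,4,6)] assms(5) by simp

text \<open>The levels on which the ancestors agree are downward closed by
  \<open>anc_eq_mono\<close>, and 0 is among them because \<open>r\<close> is the only vertex of
  level 0.\<close>

lemma meet_ge_iff:
  assumes "u \<in> V" "v \<in> V"
  shows "k \<le> meet u v \<longleftrightarrow> k \<le> l u \<and> k \<le> l v \<and> anc k u = anc k v"
proof -
  let ?S = "{k. k \<le> l u \<and> k \<le> l v \<and> anc k u = anc k v}"
  have fin: "finite ?S" by (rule finite_subset[of _ "{..l u}"]) auto
  have "anc 0 w = r" if "w \<in> V" for w
    using that lev_0D anc_in lev_anc by simp
  then have "0 \<in> ?S" using assms by simp
  then have "meet u v \<in> ?S"
    unfolding meet_def using fin by (intro Max_in) auto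
  moreover have "k \<le> meet u v" if "k \<in> ?S" for k
    unfolding meet_def using fin that by (rule Max_ge)
  ultimately show ?thesis
    using anc_eq_mono[OF assms] by auto
qed

lemma meet_le:
  assumes "u \<in> V" "v \<in> V"
  shows "meet u v \<le> l u" "meet u v \<le> l v"
  using meet_ge_iff[OF assms, of "meet u v"] by auto

lemma meet_commute: "meet u v = meet v u"
  unfolding meet_def by (intro arg_cong[where f = Max]) auto

lemma meet_self: "u \<in> V \<Longrightarrow> meet u u = l u"
  using meet_ge_iff[of u u "l u"] meet_le[of u u] by simp

text \<open>Ultrametric inequality: were both meets larger, the ancestors of \<open>u\<close>,
  \<open>v\<close> and \<open>w\<close> would still agree one level beyond
  \<open>meet u w\<close>.\<close>

lemma meet_ultra:
  assumes "u \<in> V" "v \<in> V" "w \<in> V"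
  shows "meet u v \<le> meet u w \<or> meet v w \<le> meet u w"
proof (rule ccontr)
  assume "\<not> ?thesis"
  then have "Suc (meet u w) \<le> meet u v" "Suc (meet u w) \<le> meet v w" by auto
  then have "Suc (meet u w) \<le> meet u w"
    using assms by (simp only: meet_ge_iff)
  then show False by simp
qed

lemma meet_anc: "\<lbrakk>u \<in> V; k \<le> l u\<rbrakk> \<Longrightarrow> meet (anc k u) u = k"
  by (rule antisym) (use meet_le[of "anc k u" u] in \<open>auto simp: meet_ge_iff anc_in lev_anc anc_anc\<close>)

lemma meet_eq_levs:
  assumes "u \<in> V" "v \<in> V" "l u \<le> meet u v" "l v \<le> meet u v"
  shows "u = v"
proof -
  have "l u = l v" "anc (l u) u = anc (l u) v"
    using assms meet_le[OF assms(1,2)] by (auto simp: meet_ge_iff)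
  then show ?thesis by (metis anc_self)
qed

lemma meet_parent:
  assumes "u \<in> V" "v \<in> V" "v \<noteq> r"
  shows "meet u (p v) = min (meet u v) (l (p v))"
proof (rule antisym)
  have pv: "p v \<in> V" "l v = Suc (l (p v))"
    using assms parent_in lev_parent by auto
  have le: "meet u (p v) \<le> l (p v)" using meet_le assms pv by blast
  moreover have "meet u (p v) \<le> meet u v"
    using meet_ge_iff[of u "p v" "meet u (p v)"] assms pv le
    by (simp add: meet_ge_iff anc_parent)
  ultimately show "meet u (p v) \<le> min (meet u v) (l (p v))" by simp
  let ?k = "min (meet u v) (l (p v))"
  have "?k \<le> meet u v" by simp
  then have "?k \<le> l u" "anc ?k u = anc ?k v" using assms by (simp_all only: meet_ge_iff)
  then show "?k \<le> meet u (p v)"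
    using assms pv by (simp add: meet_ge_iff anc_parent)
qed

section \<open>Distances in the tree and in its contraction, from levels and meets\<close>

definition tdist :: "'a \<Rightarrow> 'a \<Rightarrow> nat" where
  "tdist u v = l u + l v - 2 * meet u v"

text \<open>The distance between the super-vertices of \<open>u\<close> and \<open>v\<close>.\<close>

definition cdist :: "'a \<Rightarrow> 'a \<Rightarrow> nat" where
  "cdist u v = l u div 2 + l v div 2 - 2 * (meet u v div 2)"

lemma tdist_eq:
  assumes "u \<in> V" "v \<in> V"
  shows "tdist u v + 2 * meet u v = l u + l v"
  using meet_le[OF assms] by (simp add: tdist_def)

lemma cdist_eq:
  assumes "u \<in> V" "v \<in> V"
  shows "cdist u v + 2 * (meet u v div 2) = l u div 2 + l v div 2"
proof -
  have "meet u v div 2 \<le> l u div 2" "meet u v div 2 \<le> l v div 2"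
    using meet_le[OF assms] by (simp_all add: div_le_mono)
  then show ?thesis by (simp add: cdist_def)
qed

lemma tdist_commute: "tdist u v = tdist v u"
  by (simp add: tdist_def meet_commute add.commute)

lemma cdist_commute: "cdist u v = cdist v u"
  by (simp add: cdist_def meet_commute add.commute)

text \<open>Reduces to \<open>meet v u + meet v w \<le> meet u w + l v\<close>: by
  \<open>meet_ultra\<close> one summand is at most \<open>meet u w\<close>, and the other is at most
  \<open>l v\<close>.\<close>

lemma tdist_triangle:
  assumes "u \<in> V" "v \<in> V" "w \<in> V"
  shows "tdist u w \<le> tdist v u + tdist v w"
  using meet_ultra[OF assms] meet_le[OF assms(2,1)] meet_le[OF assms(2,3)]
    tdist_eq[OF assms(1,3)] tdist_eq[OF assms(2,1)] tdist_eq[OF assms(2,3)]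
  by (auto simp: meet_commute)

lemma cdist_triangle:
  assumes "u \<in> V" "v \<in> V" "w \<in> V"
  shows "cdist u w \<le> cdist v u + cdist v w"
proof -
  have "meet u v div 2 \<le> meet u w div 2 \<or> meet v w div 2 \<le> meet u w div 2"
    using meet_ultra[OF assms] by (auto intro: div_le_mono)
  moreover have "meet v u div 2 \<le> l v div 2" "meet v w div 2 \<le> l v div 2"
    using assms by (auto intro!: div_le_mono meet_le)
  ultimately show ?thesis
    using cdist_eq[OF assms(1,3)] cdist_eq[OF assms(2,1)] cdist_eq[OF assms(2,3)]
    by (auto simp: meet_commute)
qed

lemma tdist_self: "u \<in> V \<Longrightarrow> tdist u u = 0"
  by (simp add: tdist_def meet_self)

lemma cdist_self: "u \<in> V \<Longrightarrow> cdist u u = 0"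
  by (simp add: cdist_def meet_self)

text \<open>\<open>meet u v < l v\<close> means that \<open>v\<close> is neither \<open>u\<close>
  nor an ancestor of \<open>u\<close>; then the step to the parent approaches \<open>u\<close>,
  otherwise it leads away.\<close>

lemma tdist_parent:
  assumes "u \<in> V" "v \<in> V" "v \<noteq> r"
  shows "if meet u v < l v then tdist u v = Suc (tdist u (p v)) else tdist u (p v) = Suc (tdist u v)"
  using tdist_eq[of u v] tdist_eq[of u "p v"] meet_le[of u v] meet_parent[OF assms]
    lev_parent[of v] parent_in[of v] assms by (cases "meet u v < l v") (auto simp: min_def)

section \<open>Even-level representatives and the parent map of the contracted tree\<close>

text \<open>The vertex of even level in the super-vertex of \<open>v\<close>.\<close>

definition hd_even :: "'a \<Rightarrow> 'a" where
  "hd_even v = (if even (l v) then v else p v)"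

lemma
  assumes "v \<in> V"
  shows hd_even_in: "hd_even v \<in> V"
    and even_lev_hd_even: "even (l (hd_even v))"
    and lev_hd_even: "l (hd_even v) div 2 = l v div 2"
proof -
  have "v \<noteq> r" if "odd (l v)" using that lev_root by auto
  then show "hd_even v \<in> V" "even (l (hd_even v))" "l (hd_even v) div 2 = l v div 2"
    using assms lev_parent[of v] parent_in[of v] by (auto simp: hd_even_def)
qed

text \<open>For odd \<open>l u\<close>, passing to \<open>p u\<close> caps the meet at the even
  number \<open>l u - 1\<close>, which has the same half as \<open>l u\<close>.\<close>

lemma cdist_hd_even_left:
  assumes "u \<in> V" "v \<in> V"
  shows "cdist (hd_even u) v = cdist u v"
proof (cases "even (l u)")
  case False
  then have "u \<noteq> r" using lev_root by auto
  then have "meet v (p u) div 2 = meet v u div 2"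
    using False meet_parent[OF assms(2,1)] lev_parent[OF assms(1)] meet_le[OF assms(2,1)]
    by (auto simp: min_def)
  with False show ?thesis
    using lev_hd_even[OF assms(1)] by (simp add: cdist_def hd_even_def meet_commute)
qed (simp add: hd_even_def)

lemma cdist_hd_even: "\<lbrakk>u \<in> V; v \<in> V\<rbrakk> \<Longrightarrow> cdist (hd_even u) (hd_even v) = cdist u v"
  using cdist_hd_even_left hd_even_in cdist_commute by metis

text \<open>For \<open>v\<close> of even positive level, this represents the parent of its
  super-vertex in the contracted tree.\<close>

definition grandparent :: "'a \<Rightarrow> 'a" where
  "grandparent v = p (p v)"

lemma
  assumes "v \<in> V" "v \<noteq> r" "even (l v)"
  shows grandparent_in: "grandparent v \<in> V"
    and lev_grandparent: "l v = l (grandparent v) + 2"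
    and parent_not_root: "p v \<noteq> r"
    and hd_even_parent: "hd_even (p v) = grandparent v"
proof -
  show "p v \<noteq> r" using assms lev_parent[of v] lev_root by force
  then show "grandparent v \<in> V" "l v = l (grandparent v) + 2"
    using assms lev_parent parent_in by (simp_all add: grandparent_def)
  show "hd_even (p v) = grandparent v"
    using assms lev_parent[of v] by (simp add: grandparent_def hd_even_def)
qed

lemma cdist_grandparent:
  assumes "u \<in> V" "v \<in> V" "v \<noteq> r" "even (l v)"
  shows "if meet u v < l v then cdist u v = Suc (cdist u (grandparent v))
    else cdist u (grandparent v) = Suc (cdist u v)"
proof -
  note g = grandparent_in[OF assms(2-)] lev_grandparent[OF assms(2-)] parent_not_root[OF assms(2-)]
  have p: "p v \<in> V" "l v = Suc (l (p v))" using assms parent_in lev_parent by auto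
  have "meet u (grandparent v) = min (meet u v) (l v - 2)"
    using meet_parent[OF assms(1) p(1) g(3)] meet_parent[OF assms(1-3)] g(2) p(2)
    by (auto simp: grandparent_def)
  \<comment> \<open>If \<open>meet u v = l v - 1\<close>, the cap at \<open>l v - 2\<close> is lost
    on halving because \<open>l v\<close> is even.\<close>
  then have "meet u (grandparent v) div 2 = (if l v \<le> meet u v then l v div 2 - 1 else meet u v div 2)"
    using g(2) assms(4) meet_le[OF assms(1,2)] by (auto simp: min_def)
  moreover have *: "meet u v div 2 \<le> l u div 2" "meet u v div 2 \<le> l v div 2"
    using meet_le[OF assms(1,2)] by (simp_all add: div_le_mono)
  moreover have **: "meet u v div 2 < l v div 2" if "meet u v < l v"
    using that assms(4) by presburger
  moreover have "meet u v div 2 = l v div 2" if "\<not> meet u v < l v"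
    using that meet_le(2)[OF assms(1,2)] by simp
  moreover have "l v div 2 = l (grandparent v) div 2 + 1" using g(2) by simp
  ultimately show ?thesis
    using cdist_eq[OF assms(1,2)] cdist_eq[OF assms(1) g(1)]
    by (cases "meet u v < l v") auto
qed

section \<open>A vertex that is central for both distances\<close>

lemma diametral_pair:
  obtains x y where "x \<in> V" "y \<in> V" "l y \<le> l x" "\<And>u v. \<lbrakk>u \<in> V; v \<in> V\<rbrakk> \<Longrightarrow> tdist u v \<le> tdist x y"
proof -
  let ?S = "(\<lambda>(u, v). tdist u v) ` (V \<times> V)"
  have S: "finite ?S" "?S \<noteq> {}" using finite_V root_in by auto
  obtain x y where xy: "x \<in> V" "y \<in> V" "tdist x y = Max ?S"
    using Max_in[OF S] by auto
  have max: "tdist u v \<le> tdist x y" if "u \<in> V" "v \<in> V" for u v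
    using that S unfolding xy(3) by (intro Max_ge) auto
  show thesis
  proof (cases "l y \<le> l x")
    case True
    then show ?thesis using that xy max by blast
  next
    case False
    then show ?thesis using that[of y x] xy max tdist_commute by simp
  qed
qed

text \<open>The inequalities are the centrality criterion for both distances. The pairs may differ,
  since after halving a third vertex can be farther from \<open>c\<close> than \<open>x\<close>
  is.\<close>

lemma common_center:
  obtains c x y x' y' where "{c, x, y, x', y'} \<subseteq> V"
    "\<And>z. z \<in> V \<Longrightarrow> 2 * tdist c z \<le> tdist x y + 1"
    "\<And>z. z \<in> V \<Longrightarrow> 2 * cdist c z \<le> cdist x' y' + 1"
proof -
  obtain x y where xy: "x \<in> V" "y \<in> V" "l y \<le> l x"
    and max: "\<And>u v. \<lbrakk>u \<in> V; v \<in> V\<rbrakk> \<Longrightarrow> tdist u v \<le> tdist x y"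
    using diametral_pair by metis
  define D where "D = tdist x y"
  define m where "m = meet x y"
  \<comment> \<open>The radius of the tree: half the diameter, rounded up.\<close>
  define R where "R = (D + 1) div 2"
  \<comment> \<open>For odd \<open>D\<close>, the two middle vertices have levels \<open>l x - R\<close> and \<open>l x - R + 1\<close>. If \<open>l x\<close> is even
    and \<open>R\<close> is odd, then the upper one has odd level and may fail; the lower one has even level.\<close>
  define k where "k = (if odd D \<and> even (l x) \<and> odd R then l x + 1 - R else l x - R)"
  have D: "D + 2 * m = l x + l y" "m \<le> l y"
    using tdist_eq[of x y] meet_le[of x y] xy by (simp_all add: D_def m_def)
  \<comment> \<open>Since \<open>l y \<le> l x\<close>, the branch from the meet down to
    \<open>x\<close> is at least half of the path, so a middle vertex lies on it.\<close>
  have Rx: "R \<le> l x" "m + R \<le> l x" using D xy(3) unfolding R_def by auto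
  have k: "m \<le> k" "k \<le> l x"
    using Rx D unfolding k_def R_def by (auto split: if_splits)
  \<comment> \<open>Even diameter; odd diameter with the upper middle vertex; odd diameter with the
    lower one.\<close>
  have kR: "D = 2 * R \<and> l x = k + R \<or> D + 1 = 2 * R \<and> l x = k + R \<and> (odd (l x) \<or> even R) \<or>
      D + 1 = 2 * R \<and> l x + 1 = k + R \<and> even (l x) \<and> odd R"
    using Rx unfolding k_def R_def by (auto split: if_splits)
  define c where "c = anc k x"
  have c: "c \<in> V" "l c = k" "meet c x = k"
    using xy k by (auto simp: c_def anc_in lev_anc meet_anc)
  have cy: "meet c y = m"
    using meet_ultra[of c x y] meet_ultra[of x c y] meet_le[of c y] xy c k
    by (auto simp: m_def meet_commute)
  \<comment> \<open>If \<open>z\<close> is below \<open>c\<close>, it is no deeper than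
    \<open>x\<close>; otherwise the path from \<open>x\<close> to \<open>z\<close> runs through
    \<open>c\<close>, and maximality of \<open>D\<close> bounds \<open>l z\<close>.\<close>
  have below_or_above: "meet c z = k \<and> l z \<le> l x \<or>
      meet c z < k \<and> meet x z = meet c z \<and> l x + l z \<le> D + 2 * meet c z" if z: "z \<in> V" for z
  proof (cases "meet c z = k")
    case True
    have "l z \<le> l x"
    proof (cases "meet z y \<le> m")
      case True
      then show ?thesis using max[of z y] tdist_eq[of z y] z xy D by (simp add: D_def)
    next
      case False
      \<comment> \<open>Were \<open>c\<close> below the last common ancestor of \<open>x\<close> and
        \<open>y\<close>, so would be that of \<open>z\<close> and \<open>x\<close>, and
        \<open>x\<close> and \<open>y\<close> would meet below level \<open>m\<close>. Hence
        \<open>k = m\<close>, and \<open>z\<close> is compared with \<open>x\<close> instead of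
        \<open>y\<close>.\<close>
      then have "k = m" "meet x z = m"
        using True meet_ultra[of c z y] meet_ultra[of x z y] meet_ultra[of x c z] z xy c cy k
        by (auto simp: m_def meet_commute)
      then show ?thesis
        using max[of x z] tdist_eq[of x z] z xy D by (simp add: D_def)
    qed
    with True show ?thesis by simp
  next
    case False
    then have "meet c z < k" using meet_le[of c z] c z by simp
    moreover from this have "meet x z = meet c z"
      using meet_ultra[of c x z] meet_ultra[of x c z] z xy c by (auto simp: meet_commute)
    ultimately show ?thesis
      using max[of x z] tdist_eq[of x z] z xy by (simp add: D_def)
  qed
  have tdist_c: "2 * tdist c z \<le> tdist x y + 1" if z: "z \<in> V" for z
    using below_or_above[OF z] tdist_eq[OF c(1) z] c D kR
    unfolding D_def[symmetric] by auto
  have cdist_cx: "cdist c x + k div 2 = l x div 2"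
    using cdist_eq[of c x] c xy by (simp add: meet_commute)
  have cdist_c: "cdist c z \<le> cdist c x \<or>
      cdist c z \<le> cdist c x + 1 \<and> cdist x z = cdist c x + cdist c z" if z: "z \<in> V" for z
    using below_or_above[OF z]
  proof (elim disjE conjE)
    assume "meet c z = k" "l z \<le> l x"
    then show ?thesis
      using cdist_eq[OF c(1) z] c cdist_cx div_le_mono[of "l z" "l x" 2] by simp
  next
    assume *: "meet c z < k" "meet x z = meet c z" "l x + l z \<le> D + 2 * meet c z"
    have "cdist x z = cdist c x + cdist c z"
      using cdist_eq[OF c(1) z] cdist_eq[OF xy(1) z] c cdist_cx * by simp
    moreover have "cdist c z \<le> cdist c x + 1"
    proof -
      \<comment> \<open>The excess of one occurs only for the lower middle vertex; there
        \<open>l x\<close> is even, so halving absorbs it.\<close>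
      have "l z + 2 * k \<le> l x + 2 * meet c z \<or> even (l x) \<and> l z + 2 * k \<le> l x + 2 * meet c z + 1"
        using *(3) kR by auto
      then have "(l z + 2 * k) div 2 \<le> (l x + 2 * meet c z) div 2"
        by (elim disjE conjE) (auto dest: div_le_mono[where k = 2] elim!: evenE)
      then have "l z div 2 + k \<le> l x div 2 + meet c z" by simp
      \<comment> \<open>\<open>cdist c z\<close> exceeds \<open>cdist c x\<close> by at most the
        parity of \<open>meet c z\<close> minus that of \<open>k\<close>.\<close>
      then show ?thesis using cdist_eq[OF c(1) z] cdist_cx c(2) by linarith
    qed
    ultimately show ?thesis by simp
  qed
  have cdist_cy: "cdist c x \<le> cdist c y + 1"
  proof -
    \<comment> \<open>This is where the choice of middle vertex matters. The difference of
      \<open>cdist c y\<close> and \<open>cdist c x\<close> is the parity of \<open>m\<close> minus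
      that of \<open>k\<close>, less one more if the halves below differ; in that case
      \<open>k\<close> is even.\<close>
    have "l y + 2 * k = l x + 2 * m \<or> even (l x) \<and> l y + 2 * k = l x + 2 * m + 1 \<or>
        (odd (l x) \<or> even k) \<and> l y + 2 * k + 1 = l x + 2 * m"
      using D kR by auto
    then have "(l y + 2 * k) div 2 = (l x + 2 * m) div 2 \<or>
        even k \<and> (l y + 2 * k) div 2 + 1 = (l x + 2 * m) div 2"
    proof (elim disjE[of "l y + 2 * k = l x + 2 * m"] disjE[of "even (l x) \<and> _"] conjE)
      assume "even (l x)" "l y + 2 * k = l x + 2 * m + 1"
      then show ?thesis by simp
    next
      assume "odd (l x) \<or> even k" and *: "l y + 2 * k + 1 = l x + 2 * m"
      moreover have "(l y + 2 * k) div 2 = (l x + 2 * m) div 2" if "odd (l x)"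
      proof -
        have "even (l y + 2 * k)" using * that by presburger
        then show ?thesis unfolding *[symmetric] by simp
      qed
      moreover have "(l y + 2 * k) div 2 + 1 = (l x + 2 * m) div 2" if "even (l x)"
      proof -
        have "odd (l y + 2 * k)" using * that by presburger
        then show ?thesis unfolding *[symmetric] by simp
      qed
      ultimately show ?thesis by blast
    qed simp
    then have "l y div 2 + k = l x div 2 + m \<or> even k \<and> l y div 2 + k + 1 = l x div 2 + m"
      by (simp add: add.commute)
    then show ?thesis using cdist_eq[OF c(1) xy(2)] cdist_cx c(2) cy by (elim disjE conjE) auto
  qed
  have cdist_xy: "cdist x y = cdist c x + cdist c y"
    using cdist_eq[OF c(1) xy(2)] cdist_eq[OF xy(1,2)] cdist_cx c cy by (simp add: m_def)
  \<comment> \<open>Take \<open>z\<close> farthest from \<open>c\<close>. If it is no farther than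
    \<open>x\<close>, the pair \<open>x\<close>, \<open>y\<close> works by \<open>cdist_cy\<close>;
    otherwise it is one farther and \<open>x\<close>, \<open>z\<close> works.\<close>
  have "finite (cdist c ` V)" "cdist c ` V \<noteq> {}" using finite_V root_in by auto
  from Max_in[OF this] Max_ge[OF this(1)]
  obtain z where z: "z \<in> V" "\<And>w. w \<in> V \<Longrightarrow> cdist c w \<le> cdist c z"
    by (metis (no_types, lifting) imageE imageI)
  show thesis
  proof (cases "cdist c z \<le> cdist c x")
    case True
    then have "2 * cdist c w \<le> cdist x y + 1" if "w \<in> V" for w
      using z(2)[OF that] cdist_xy cdist_cy by linarith
    then show ?thesis
      using that[of c x y x y] c(1) xy tdist_c by simp
  next
    case False
    then have "2 * cdist c z \<le> cdist x z + 1" using cdist_c[OF z(1)] by linarith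
    then have "2 * cdist c w \<le> cdist x z + 1" if "w \<in> V" for w
      using z(2)[OF that] by linarith
    then show ?thesis
      using that[of c x y x z] c(1) xy z(1) tdist_c by simp
  qed
qed

end

section \<open>Shortest-path distances and centers\<close>

context wf_digraph
begin

lemma gdist_le: "awalk u q v \<Longrightarrow> gdist G u v \<le> length q"
  unfolding gdist_def by (intro Least_le) blast

lemma gdist_awalk:
  assumes "awalk u q v"
  obtains q' where "awalk u q' v" "length q' = gdist G u v"
proof -
  have "\<exists>n p. awalk u p v \<and> length p = n" using assms by blast
  from LeastI_ex[OF this] show thesis using that by (auto simp: gdist_def)
qed

text \<open>Along an arc \<open>D u\<close> grows by at most one, so no walk is shorter than
  \<open>D\<close>; moving one end closer repeatedly builds a walk of length at most
  \<open>D\<close>. Either end may move because only a vertex that is not an ancestor of the other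
  approaches it via its parent.\<close>

lemma gdist_eqI:
  assumes verts: "verts G = f ` I" and inj: "inj_on f I"
    and self: "\<And>u. u \<in> I \<Longrightarrow> D u u = 0"
    and lip: "\<And>u v w. \<lbrakk>u \<in> I; v \<in> I; w \<in> I; f v \<rightarrow>\<^bsub>G\<^esub> f w\<rbrakk> \<Longrightarrow> D u w \<le> D u v + 1"
    and closer: "\<And>u v. \<lbrakk>u \<in> I; v \<in> I; u \<noteq> v\<rbrakk> \<Longrightarrow>
      (\<exists>w \<in> I. f w \<rightarrow>\<^bsub>G\<^esub> f v \<and> D u w < D u v) \<or> (\<exists>w \<in> I. f u \<rightarrow>\<^bsub>G\<^esub> f w \<and> D w v < D u v)"
    and uv: "u \<in> I" "v \<in> I"
  shows "gdist G (f u) (f v) = D u v"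
proof -
  have upper: "\<exists>p. awalk (f u) p (f v) \<and> length p \<le> D u v" using uv
  proof (induction "D u v" arbitrary: u v rule: less_induct)
    case less
    show ?case
    proof (cases "u = v")
      case True
      then have "awalk (f u) [] (f v)" using less.prems verts by (simp add: awalk_Nil_iff)
      then show ?thesis by fastforce
    next
      case False
      with closer less.prems consider
        w where "w \<in> I" "f w \<rightarrow>\<^bsub>G\<^esub> f v" "D u w < D u v" | w where "w \<in> I" "f u \<rightarrow>\<^bsub>G\<^esub> f w" "D w v < D u v"
        by blast
      then show ?thesis
      proof cases
        case 1
        then obtain p where "awalk (f u) p (f w)" "length p \<le> D u w"
          using less by blast
        moreover from 1 obtain e where "e \<in> arcs G" "tail G e = f w" "head G e = f v"
          by (auto simp: arcs_ends_conv)
        then have "awalk (f w) [e] (f v)" using arc_implies_awalk by metis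
        ultimately have "awalk (f u) (p @ [e]) (f v)" "length (p @ [e]) \<le> D u v"
          using 1 by (auto intro: awalk_appendI)
        then show ?thesis by blast
      next
        case 2
        then obtain p where "awalk (f w) p (f v)" "length p \<le> D w v"
          using less by blast
        moreover from 2 obtain e where "e \<in> arcs G" "tail G e = f u" "head G e = f w"
          by (auto simp: arcs_ends_conv)
        ultimately have "awalk (f u) (e # p) (f v)" "length (e # p) \<le> D u v"
          using 2 by (auto simp: awalk_Cons_iff)
        then show ?thesis by blast
      qed
    qed
  qed
  \<comment> \<open>Generalised to any start \<open>u'\<close> for the induction on the walk; the
    case \<open>u' = u\<close> gives the bound.\<close>
  have lower: "D u v \<le> D u u' + length p" if "awalk (f u') p (f v)" "u' \<in> I" for u' p
    using that
  proof (induction p arbitrary: u')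
    case Nil
    then have "u' = v" using inj uv by (auto simp: awalk_Nil_iff inj_on_def)
    then show ?case by simp
  next
    case (Cons e p)
    then have e: "e \<in> arcs G" "tail G e = f u'" "awalk (head G e) p (f v)"
      by (auto simp: awalk_Cons_iff)
    then obtain w where w: "w \<in> I" "head G e = f w"
      using verts by (metis head_in_verts imageE)
    then have "f u' \<rightarrow>\<^bsub>G\<^esub> f w" using e by (metis in_arcs_imp_in_arcs_ends)
    then show ?case using lip[OF uv(1) Cons.prems(2) w(1)] Cons.IH[of w] e w by simp
  qed
  from upper obtain p where "awalk (f u) p (f v)" "length p \<le> D u v" by blast
  then obtain q where "awalk (f u) q (f v)" "length q = gdist G (f u) (f v)"
    using gdist_awalk by blast
  then show ?thesis
    using lower[of u q] gdist_le[OF \<open>awalk (f u) p (f v)\<close>] self uv \<open>length p \<le> D u v\<close> by simp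
qed

end

text \<open>\<open>2 ecc(c) \<le> d(x, y) + 1 \<le> 2 ecc(u) + 1\<close> for every \<open>u\<close>,
  and parity removes the one.\<close>

lemma graph_centerI:
  assumes "finite (verts G)" "c \<in> verts G" "x \<in> verts G" "y \<in> verts G"
    and tri: "\<And>u. u \<in> verts G \<Longrightarrow> gdist G x y \<le> gdist G u x + gdist G u y"
    and ecc: "\<And>z. z \<in> verts G \<Longrightarrow> 2 * gdist G c z \<le> gdist G x y + 1"
  shows "c \<in> graph_center G"
proof -
  have "eccentricity G c \<le> eccentricity G u" if u: "u \<in> verts G" for u
  proof -
    have "eccentricity G c \<in> gdist G c ` verts G"
      unfolding eccentricity_def using assms by (intro Max_in) auto
    then have "2 * eccentricity G c \<le> gdist G x y + 1" using ecc by auto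
    moreover have "gdist G u z \<le> eccentricity G u" if "z \<in> verts G" for z
      unfolding eccentricity_def using assms that by (intro Max_ge) auto
    then have "gdist G u x \<le> eccentricity G u" "gdist G u y \<le> eccentricity G u"
      using assms by auto
    ultimately show ?thesis using tri[OF u] by linarith
  qed
  then show ?thesis using assms by (simp add: graph_center_def)
qed

section \<open>Parents in undirected trees\<close>

locale rooted_undirected_tree = pair_graph T for T :: "'a pair_pre_digraph" +
  fixes r :: 'a
  assumes root_vert: "r \<in> pverts T"
    and reachable: "\<lbrakk>u \<in> pverts T; v \<in> pverts T\<rbrakk> \<Longrightarrow> u \<rightarrow>\<^sup>*\<^bsub>with_proj T\<^esub> v"
    and no_cycle: "cycle p \<Longrightarrow> length p < 3"
begin

abbreviation lev :: "'a \<Rightarrow> nat" where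
  "lev \<equiv> level T r"

lemma awalk_to_root:
  assumes "v \<in> pverts T"
  obtains q where "awalk v q r" "length q = lev v"
proof -
  obtain q where "awalk v q r"
    using reachable[OF assms root_vert] by (auto simp: reachable_awalk)
  then show thesis using gdist_awalk that unfolding level_def by blast
qed

lemma level_root: "lev r = 0"
  using gdist_le[of r "[]" r] root_vert by (simp add: level_def awalk_Nil_iff)

lemma level_0D: "\<lbrakk>v \<in> pverts T; lev v = 0\<rbrakk> \<Longrightarrow> v = r"
  by (rule awalk_to_root[of v]) (auto simp: awalk_Nil_iff)

lemma level_arc:
  assumes "(u, v) \<in> parcs T"
  shows "lev u \<le> Suc (lev v)"
proof -
  obtain q where "awalk v q r" "length q = lev v"
    using awalk_to_root assms in_arcsD2 by blast
  then have "awalk u ((u, v) # q) r" using assms by (simp add: awalk_Cons_iff)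
  from gdist_le[OF this] show ?thesis using \<open>length q = lev v\<close> by (simp add: level_def)
qed

lemma ex_parent:
  assumes "v \<in> pverts T" "v \<noteq> r"
  shows "\<exists>u. (v, u) \<in> parcs T \<and> lev v = Suc (lev u)"
proof -
  obtain q where q: "awalk v q r" "length q = lev v"
    using awalk_to_root assms by blast
  then obtain e q' where "q = e # q'" using assms by (cases q) (auto simp: awalk_Nil_iff)
  then have e: "(v, snd e) \<in> parcs T" "awalk (snd e) q' r" "lev v = Suc (length q')"
    using q by (auto simp: awalk_Cons_iff)
  then have "lev (snd e) \<le> length q'" unfolding level_def by (intro gdist_le)
  then show ?thesis using e level_arc[of v "snd e"] by force
qed

section \<open>Uniqueness of parents from the absence of cycles\<close>

lemma awalk_to_root_low:
  assumes "v \<in> pverts T" "lev v \<le> n"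
  shows "\<exists>q. awalk v q r \<and> (\<forall>w \<in> set (pawalk_verts v q). lev w \<le> n)"
  using assms
proof (induction "lev v" arbitrary: v)
  case 0
  then show ?case by (intro exI[of _ "[]"]) (auto simp: awalk_Nil_iff dest: level_0D)
next
  case (Suc m)
  then have "v \<noteq> r" using level_root by auto
  then obtain u where u: "(v, u) \<in> parcs T" "lev v = Suc (lev u)"
    using ex_parent Suc.prems by blast
  then obtain q where "awalk u q r" "\<forall>w \<in> set (pawalk_verts u q). lev w \<le> n"
    using Suc in_arcsD2 by force
  then show ?case using u Suc.prems by (intro exI[of _ "(v, u) # q"]) (auto simp: awalk_Cons_iff)
qed

text \<open>Join the two descending walks at the root and shorten the result to a path; its vertices
  are among those of the walk.\<close>

lemma apath_low:
  assumes "u \<in> pverts T" "v \<in> pverts T" "lev u \<le> n" "lev v \<le> n"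
  obtains q where "apath u q v" "\<forall>w \<in> set (pawalk_verts u q). lev w \<le> n"
proof -
  obtain q1 q2 where q: "awalk u q1 r" "\<forall>w \<in> set (pawalk_verts u q1). lev w \<le> n"
      "awalk v q2 r" "\<forall>w \<in> set (pawalk_verts v q2). lev w \<le> n"
    using awalk_to_root_low assms by metis
  have "set (pawalk_verts r (rev_path q2)) = set (pawalk_verts v q2)"
    using awalk_verts_rev_path[OF q(3)] by simp
  then have low: "awalk u (q1 @ rev_path q2) v" "\<forall>w \<in> set (pawalk_verts u (q1 @ rev_path q2)). lev w \<le> n"
    using q by (auto simp: set_awalk_verts_append intro: awalk_appendI)
  moreover define q where "q = awalk_to_apath (q1 @ rev_path q2)"
  ultimately have "apath u q v" "awalk u (q1 @ rev_path q2) v" "set q \<subseteq> set (q1 @ rev_path q2)"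
    using apath_awalk_to_apath awalk_to_apath_subset by blast+
  moreover from this have "set (pawalk_verts u q) \<subseteq> set (pawalk_verts u (q1 @ rev_path q2))"
    using set_awalk_verts[of u q v] set_awalk_verts[of u "q1 @ rev_path q2" v]
    by (auto simp: apath_def)
  ultimately show thesis
    using that low by blast
qed

text \<open>
  Two vertices on the same level that coincide or are adjacent are also joined through strictly lower
  levels. Hence parents are unique and no edge stays on one level.
\<close>

lemma low_cycle_absurd:
  assumes "(s', s) \<in> parcs T" "(t, t') \<in> parcs T"
    and lev: "lev s = Suc n" "lev t = Suc n" "lev s' = n" "lev t' = n"
    and st: "s = t \<and> s' \<noteq> t' \<or> (s, t) \<in> parcs T"
  shows False
proof -
  have "s' \<in> pverts T" "t' \<in> pverts T" using assms in_arcsD1 in_arcsD2 by blast+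
  then obtain q where q: "apath t' q s'" and low: "\<forall>w \<in> set (pawalk_verts t' q). lev w \<le> n"
    using apath_low lev by (metis order_refl)
  then have walk: "awalk t' (q @ [(s', s)]) s"
    using assms(1) by (auto simp: apath_def awalk_simps intro: in_arcsD2)
  have "pawalk_verts t' (q @ [(s', s)]) = pawalk_verts t' q @ [s]"
    using awalk_verts_append[OF walk] by simp
  moreover have "s \<notin> set (pawalk_verts t' q)" "t \<notin> set (pawalk_verts t' q)"
    using low lev by auto
  ultimately have dist: "distinct (pawalk_verts t' (q @ [(s', s)]))"
      "t \<noteq> s \<Longrightarrow> t \<notin> set (pawalk_verts t' (q @ [(s', s)]))"
    using q by (auto simp: apath_def)
  from st show False
  proof (elim disjE conjE)
    assume "s = t" "s' \<noteq> t'"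
    \<comment> \<open>A nonempty \<open>q\<close> brings the cycle to length 3; in the other case
      the arc from \<open>s\<close> to \<open>t\<close> already does.\<close>
    then have "q \<noteq> []" using q by (auto simp: apath_Nil_iff)
    have "cycle ((t, t') # q @ [(s', s)])"
      unfolding cycle_def using walk dist \<open>s = t\<close> assms(2)
      by (intro exI[of _ t]) (simp add: awalk_Cons_iff del: awalk_append_iff)
    from no_cycle[OF this] show False using \<open>q \<noteq> []\<close> by (cases q) auto
  next
    assume "(s, t) \<in> parcs T"
    then have "t \<noteq> s" using pair_no_loops by force
    have "cycle ((s, t) # (t, t') # q @ [(s', s)])"
      unfolding cycle_def using walk dist \<open>t \<noteq> s\<close> \<open>(s, t) \<in> parcs T\<close> assms(2)
      by (intro exI[of _ s]) (simp add: awalk_Cons_iff del: awalk_append_iff)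
    from no_cycle[OF this] show False by simp
  qed
qed

definition parent :: "'a \<Rightarrow> 'a" where
  "parent v = (SOME u. (v, u) \<in> parcs T \<and> lev v = Suc (lev u))"

lemma
  assumes "v \<in> pverts T" "v \<noteq> r"
  shows arc_parent: "(v, parent v) \<in> parcs T" and level_parent: "lev v = Suc (lev (parent v))"
  using someI_ex[OF ex_parent[OF assms]] by (simp_all add: parent_def)

lemma parent_vert: "\<lbrakk>v \<in> pverts T; v \<noteq> r\<rbrakk> \<Longrightarrow> parent v \<in> pverts T"
  using arc_parent in_arcsD2 by blast

text \<open>Otherwise the arc joins vertices of equal level or leads to a second parent of
  \<open>u\<close>; \<open>low_cycle_absurd\<close> excludes both.\<close>

lemma arc_up:
  assumes "(u, v) \<in> parcs T" "lev v \<le> lev u"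
  shows "u \<noteq> r \<and> v = parent u"
proof -
  have uv: "u \<in> pverts T" "v \<in> pverts T" "u \<noteq> v"
    using assms in_arcsD1 in_arcsD2 pair_no_loops by force+
  then have "u \<noteq> r" using assms(2) level_root level_0D[of v] by auto
  then obtain n where n: "lev u = Suc n" "lev (parent u) = n"
    using level_parent uv by blast
  note u = arc_parent[OF uv(1) \<open>u \<noteq> r\<close>]
  show ?thesis
  proof (cases "lev v = lev u")
    case True
    then have "v \<noteq> r" using n level_root by auto
    have "lev (parent v) = n"
      using level_parent[OF uv(2) \<open>v \<noteq> r\<close>] n(1) True by linarith
    moreover have "lev v = Suc n" using n(1) True by simp
    ultimately have False
      using low_cycle_absurd[OF arcs_symmetric[OF u] arc_parent[OF uv(2) \<open>v \<noteq> r\<close>]] n assms(1) by blast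
    then show ?thesis ..
  next
    case False
    then have "lev v = n" using level_arc[OF assms(1)] assms(2) n by simp
    then show ?thesis
      using low_cycle_absurd[OF arcs_symmetric[OF assms(1)] u n(1,1) _ n(2)] \<open>u \<noteq> r\<close> by blast
  qed
qed

lemma arc_cases:
  assumes "(u, v) \<in> parcs T"
  shows "u \<noteq> r \<and> v = parent u \<or> v \<noteq> r \<and> u = parent v"
  using arc_up[of u v] arc_up[of v u] assms arcs_symmetric by (meson nle_le)

sublocale rooted_tree "pverts T" lev parent r
  by (rule rooted_tree.intro[OF pair_finite_verts root_vert level_root level_0D parent_vert level_parent])

lemma gdist_tdist:
  assumes "u \<in> pverts T" "v \<in> pverts T"
  shows "gdist (with_proj T) u v = tdist u v"
proof -
  have "gdist (with_proj T) (id u) (id v) = tdist u v"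
  proof (rule gdist_eqI[where I = "pverts T"])
    fix u v w assume *: "u \<in> pverts T" "v \<in> pverts T" "w \<in> pverts T" "(id v, id w) \<in> parcs T"
    then show "tdist u w \<le> tdist u v + 1"
      using arc_cases[of v w] tdist_parent[of u v] tdist_parent[of u w]
      by (auto split: if_splits)
  next
    fix u v assume *: "u \<in> pverts T" "v \<in> pverts T" "u \<noteq> v"
    \<comment> \<open>Of two distinct vertices at least one lies strictly below their meet; that one
      moves to its parent.\<close>
    then have "meet v u < lev u \<or> meet u v < lev v"
      using meet_eq_levs[of u v] by (force simp: meet_commute)
    then show "(\<exists>w\<in>pverts T. (id w, id v) \<in> parcs T \<and> tdist u w < tdist u v) \<or>
        (\<exists>w\<in>pverts T. (id u, id w) \<in> parcs T \<and> tdist w v < tdist u v)"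
    proof
      assume m: "meet v u < lev u"
      then have "u \<noteq> r" using level_root by auto
      then show ?thesis
        using tdist_parent[of v u] m * arc_parent[of u] parent_in[of u]
        by (auto simp: tdist_commute intro!: bexI[of _ "parent u"])
    next
      assume m: "meet u v < lev v"
      then have "v \<noteq> r" using level_root by auto
      then show ?thesis
        using tdist_parent[of u v] m * arc_parent[of v] parent_in[of v] arcs_symmetric
        by (auto intro!: bexI[of _ "parent v"])
    qed
  qed (use assms tdist_self in auto)
  then show ?thesis by simp
qed

end

section \<open>The contracted tree\<close>

context rooted_undirected_tree
begin

definition even_verts :: "'a set" where
  "even_verts = {v \<in> pverts T. even (lev v)}"

definition star :: "'a \<Rightarrow> 'a set" where
  "star v = {v} \<union> down_neighbours T r v"

abbreviation P :: "'a set set" where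
  "P \<equiv> outward_contraction T r"

lemma outward_contraction_eq: "P = star ` even_verts"
  by (auto simp: outward_contraction_def even_verts_def star_def)

lemma hd_even_in_even_verts: "v \<in> pverts T \<Longrightarrow> hd_even v \<in> even_verts"
  by (simp add: even_verts_def hd_even_in even_lev_hd_even)

lemma hd_even_of_even: "v \<in> even_verts \<Longrightarrow> hd_even v = v"
  by (simp add: even_verts_def hd_even_def)

text \<open>The super-vertices are the fibres of \<open>hd_even\<close>; this makes them disjoint
  and \<open>natural_map\<close> well defined.\<close>

lemma mem_star_iff:
  assumes "v \<in> even_verts"
  shows "x \<in> star v \<longleftrightarrow> x \<in> pverts T \<and> hd_even x = v"
proof
  assume "x \<in> star v"
  then consider "x = v" | "(v, x) \<in> parcs T" "lev v < lev x"
    by (auto simp: star_def down_neighbours_def)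
  then show "x \<in> pverts T \<and> hd_even x = v"
  proof cases
    case 1
    then show ?thesis using assms by (simp add: hd_even_of_even) (simp add: even_verts_def)
  next
    case 2
    then have x: "x \<in> pverts T" "x \<noteq> r" "v = parent x"
      using arc_up[OF arcs_symmetric[OF 2(1)]] in_arcsD2 by auto
    then have "odd (lev x)" using level_parent[OF x(1,2)] assms by (simp add: even_verts_def)
    then show ?thesis using x by (simp add: hd_even_def)
  qed
next
  assume x: "x \<in> pverts T \<and> hd_even x = v"
  show "x \<in> star v"
  proof (cases "even (lev x)")
    case True
    then show ?thesis using x by (simp add: star_def hd_even_def)
  next
    case False
    then have "x \<noteq> r" using level_root by auto
    then show ?thesis
      using False x arc_parent[of x] level_parent[of x] arcs_symmetric
      by (auto simp: star_def down_neighbours_def hd_even_def)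
  qed
qed

lemma inj_on_star: "inj_on star even_verts"
proof (rule inj_onI)
  fix u v assume *: "u \<in> even_verts" "v \<in> even_verts" "star u = star v"
  then have "u \<in> star v" by (auto simp: star_def)
  then show "u = v" using * by (simp add: mem_star_iff hd_even_of_even)
qed

lemma natural_map_eq:
  assumes "v \<in> pverts T"
  shows "natural_map P v = star (hd_even v)"
  unfolding natural_map_def
  by (rule the_equality)
    (use assms hd_even_in_even_verts in \<open>auto simp: outward_contraction_eq mem_star_iff\<close>)

text \<open>A vertex of odd level shares its super-vertex with its parent. So the arc joins a vertex
  of even level to its parent, whose representative is the grandparent.\<close>

lemma arc_hd_even:
  assumes "(a, b) \<in> parcs T" "hd_even a \<noteq> hd_even b"
  shows "hd_even a \<noteq> r \<and> hd_even b = grandparent (hd_even a) \<or>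
    hd_even b \<noteq> r \<and> hd_even a = grandparent (hd_even b)"
proof -
  have up: "hd_even a \<noteq> r \<and> hd_even (parent a) = grandparent (hd_even a)"
    if "a \<in> pverts T" "a \<noteq> r" "hd_even a \<noteq> hd_even (parent a)" for a
  proof -
    have "even (lev a)"
      using that level_parent[of a] by (auto simp: hd_even_def split: if_splits)
    then show ?thesis using that hd_even_parent[of a] by (simp add: hd_even_def)
  qed
  have "a \<in> pverts T" "b \<in> pverts T" using assms in_arcsD1 in_arcsD2 by blast+
  then show ?thesis using arc_cases[OF assms(1)] up[of a] up[of b] assms(2) by auto
qed

abbreviation T' :: "'a set pair_pre_digraph" where
  "T' \<equiv> partition_graph T P"

lemma partition_graph_simps:
  "pverts T' = star ` even_verts"
  "(A, B) \<in> parcs T' \<longleftrightarrow> A \<in> P \<and> B \<in> P \<and> A \<noteq> B \<and> (\<exists>a \<in> A. \<exists>b \<in> B. (a, b) \<in> parcs T)"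
  by (auto simp: partition_graph_def outward_contraction_eq)

lemma star_arc_cases:
  assumes "(star u, star v) \<in> parcs T'" "u \<in> even_verts" "v \<in> even_verts"
  shows "u \<noteq> r \<and> v = grandparent u \<or> v \<noteq> r \<and> u = grandparent v"
proof -
  obtain a b where "a \<in> star u" "b \<in> star v" "(a, b) \<in> parcs T" "u \<noteq> v"
    using assms(1) by (auto simp: partition_graph_simps)
  then show ?thesis using assms(2,3) arc_hd_even by (auto simp: mem_star_iff)
qed

text \<open>The arc between \<open>v\<close> and \<open>parent v\<close> is the witness, as
  \<open>parent v\<close> belongs to the super-vertex of \<open>grandparent v\<close>.\<close>

lemma star_arc_grandparent:
  assumes "v \<in> even_verts" "v \<noteq> r"
  shows "grandparent v \<in> even_verts" "(star v, star (grandparent v)) \<in> parcs T'"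
    "(star (grandparent v), star v) \<in> parcs T'"
proof -
  have v: "v \<in> pverts T" "even (lev v)" using assms by (auto simp: even_verts_def)
  note g = grandparent_in[OF v(1) assms(2) v(2)] lev_grandparent[OF v(1) assms(2) v(2)]
  show ge: "grandparent v \<in> even_verts" using g v by (simp add: even_verts_def)
  have "star v \<noteq> star (grandparent v)"
  proof
    assume "star v = star (grandparent v)"
    then have "v = grandparent v" using inj_onD[OF inj_on_star] assms(1) ge by blast
    then have "lev v = lev (grandparent v)" by (rule arg_cong)
    with g(2) show False by linarith
  qed
  moreover have "v \<in> star v" "parent v \<in> star (grandparent v)"
    using v assms(2) hd_even_parent[OF v(1) assms(2) v(2)] parent_vert[OF v(1) assms(2)]
    by (simp_all add: mem_star_iff[OF assms(1)] mem_star_iff[OF ge] hd_even_of_even[OF assms(1)])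
  moreover have "(v, parent v) \<in> parcs T" "(parent v, v) \<in> parcs T"
    using arc_parent[OF v(1) assms(2)] arcs_symmetric by blast+
  ultimately show "(star v, star (grandparent v)) \<in> parcs T'" "(star (grandparent v), star v) \<in> parcs T'"
    using assms(1) ge unfolding partition_graph_simps unfolding outward_contraction_eq by blast+
qed

text \<open>\<open>gdist_eqI\<close> indexed by the even vertices, with \<open>grandparent\<close>
  in the role of the parent.\<close>

lemma gdist_star:
  assumes "u \<in> even_verts" "v \<in> even_verts"
  shows "gdist (with_proj T') (star u) (star v) = cdist u v"
proof -
  interpret T': pair_wf_digraph T'
    by unfold_locales (auto simp: partition_graph_def)
  have even: "u \<in> pverts T" "even (lev u)" if "u \<in> even_verts" for u
    using that by (auto simp: even_verts_def)
  show ?thesis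
  proof (rule T'.gdist_eqI[OF _ inj_on_star])
    fix u v w
    assume *: "u \<in> even_verts" "v \<in> even_verts" "w \<in> even_verts" "(star v, star w) \<in> parcs T'"
    from star_arc_cases[OF *(4,2,3)] show "cdist u w \<le> cdist u v + 1"
      using cdist_grandparent[OF even(1)[OF *(1)] even(1)[OF *(2)] _ even(2)[OF *(2)]]
        cdist_grandparent[OF even(1)[OF *(1)] even(1)[OF *(3)] _ even(2)[OF *(3)]]
      by (auto split: if_splits)
  next
    fix u v assume *: "u \<in> even_verts" "v \<in> even_verts" "u \<noteq> v"
    then have "meet v u < lev u \<or> meet u v < lev v"
      using meet_eq_levs[of u v] even by (force simp: meet_commute)
    then show "(\<exists>w\<in>even_verts. (star w, star v) \<in> parcs T' \<and> cdist u w < cdist u v) \<or>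
        (\<exists>w\<in>even_verts. (star u, star w) \<in> parcs T' \<and> cdist w v < cdist u v)"
    proof
      assume m: "meet v u < lev u"
      then have "u \<noteq> r" using level_root by auto
      then have "cdist (grandparent u) v < cdist u v"
        using cdist_grandparent[of v u] m * even by (simp add: cdist_commute)
      then show ?thesis using star_arc_grandparent[OF *(1) \<open>u \<noteq> r\<close>] by blast
    next
      assume m: "meet u v < lev v"
      then have "v \<noteq> r" using level_root by auto
      then have "cdist u (grandparent v) < cdist u v"
        using cdist_grandparent[of u v] m * even by simp
      then show ?thesis using star_arc_grandparent[OF *(2) \<open>v \<noteq> r\<close>] by blast
    qed
  qed (use assms even cdist_self partition_graph_simps in auto)
qed

section \<open>Transfer to the natural map and the centers\<close>

lemma gdist_natural_map:
  assumes "u \<in> pverts T" "v \<in> pverts T"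
  shows "gdist (with_proj T') (natural_map P u) (natural_map P v) = cdist u v"
  using assms by (simp add: natural_map_eq gdist_star hd_even_in_even_verts cdist_hd_even)

lemma pverts_partition_graph: "pverts T' = natural_map P ` pverts T"
proof -
  have "star ` even_verts = (\<lambda>v. star (hd_even v)) ` pverts T"
    using hd_even_in_even_verts hd_even_of_even by (force simp: even_verts_def)
  then show ?thesis by (simp add: partition_graph_simps natural_map_eq)
qed

lemma ex_common_center:
  "\<exists>c \<in> graph_center (with_proj T). natural_map P c \<in> graph_center (with_proj T')"
proof -
  obtain c x y x' y' where V: "{c, x, y, x', y'} \<subseteq> pverts T"
    and ecc: "\<And>z. z \<in> pverts T \<Longrightarrow> 2 * tdist c z \<le> tdist x y + 1"
    and ecc': "\<And>z. z \<in> pverts T \<Longrightarrow> 2 * cdist c z \<le> cdist x' y' + 1"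
    by (rule common_center) blast
  have "c \<in> graph_center (with_proj T)"
    by (rule graph_centerI[of _ c x y])
      (use V ecc tdist_triangle pair_finite_verts in \<open>auto simp: gdist_tdist\<close>)
  moreover have "natural_map P c \<in> graph_center (with_proj T')"
    by (rule graph_centerI[of _ _ "natural_map P x'" "natural_map P y'"])
      (use V ecc' cdist_triangle pair_finite_verts in
        \<open>auto simp: gdist_natural_map pverts_partition_graph\<close>)
  ultimately show ?thesis ..
qed

end

theorem theorem5:
  fixes T :: "'a pair_pre_digraph" and r :: 'a
  assumes "undirected_tree T" and "r \<in> pverts T"
  defines "P \<equiv> outward_contraction T r"
  defines "T' \<equiv> partition_graph T P"
  defines "\<phi> \<equiv> natural_map P"
  shows "center_shift (with_proj T) (with_proj T') \<phi> = 0
    \<and> center_preimage (with_proj T) (with_proj T') \<phi> \<inter> graph_center (with_proj T) \<noteq> {}"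
proof -
  from assms(1) interpret pair_graph T by (simp add: undirected_tree_def)
  interpret rooted_undirected_tree T r
  proof
    have "strongly_connected (with_proj T)"
      using assms(1) symmetric_connected_imp_strongly_connected[OF pair_sym_arcs]
      by (simp add: undirected_tree_def)
    then show "u \<rightarrow>\<^sup>*\<^bsub>with_proj T\<^esub> v" if "u \<in> pverts T" "v \<in> pverts T" for u v
      using that by (simp add: strongly_connected_def)
    show "length p < 3" if "cycle p" for p
      using that assms(1) by (auto simp: undirected_tree_def not_le[symmetric])
  qed (fact assms(2))
  obtain c where c: "c \<in> graph_center (with_proj T)" "\<phi> c \<in> graph_center (with_proj T')"
    using ex_common_center unfolding P_def T'_def \<phi>_def by blast
  let ?C = "graph_center (with_proj T)" and ?D = "center_preimage (with_proj T) (with_proj T') \<phi>"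
  have c_verts: "c \<in> pverts T" using c by (simp add: graph_center_def)
  then have c_in: "c \<in> ?D" using c by (simp add: center_preimage_def)
  \<comment> \<open>\<open>set_dist\<close> is a \<open>Min\<close>: finiteness lets the distance 0
    from \<open>c\<close> to itself bound it.\<close>
  have "finite ((\<lambda>(a, b). gdist (with_proj T) a b) ` (?C \<times> ?D))"
    using pair_finite_verts by (simp add: graph_center_def center_preimage_def)
  moreover have "{gdist (with_proj T) a b | a b. a \<in> ?C \<and> b \<in> ?D} =
      (\<lambda>(a, b). gdist (with_proj T) a b) ` (?C \<times> ?D)"
    by auto
  moreover have "gdist (with_proj T) c c = 0"
    using c_verts by (simp add: gdist_tdist tdist_self)
  ultimately have "center_shift (with_proj T) (with_proj T') \<phi> \<le> 0"
    unfolding center_shift_def set_dist_def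
    using c c_in by (intro Min_le) force+
  then show ?thesis using c c_in by auto
qed

end
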